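(* Fix $m,p\in\mathbb N$. Let $X,Y$ be separable Hilbert spaces, $D_G\subset X$ closed, $G:D_G\to Y$ continuous, and $\mathscr G:X\to Y$ a continuous extension of $G$. Assume there are $C_{\mathrm{stab}}>0$, $\beta\in(0,1)$, $\tau\in(0,1)$ with $$\|G(x_1)-G(x_2)\|_Y\le C_{\mathrm{stab}}\,|\log\|x_1-x_2\|_X|^{-\beta}\quad\text{for all }x_1,x_2\in D_G,\ \|x_1-x_2\|_X\le\tau .$$ Let $\mu$ be a Borel probability measure on $X$ with $\mu(D_G)=1$, finite second moment, and $\mathscr G\in L^2(X,\mu;Y)$. Let $\mathcal E:X\to\mathbb R^m$ be Borel measurable with $K:=\operatorname{supp}(\mathcal E_\#\mu)$ compact, let $\mathcal D:\mathbb R^m\to X$ and $\mathcal P:Y\to\mathbb R^p$ be Lipschitz continuous with $\mathcal D(K)\subset D_G$, and assume $$\varepsilon_m:=\operatorname*{ess\,sup}_{x\in X}\|\mathcal D\circ\mathcal E(x)-x\|_X\le\min\{\tau,e^{-1}\}$$ (essential supremum with respect to $\mu$). Let $\mathcal R:\mathbb R^p\to Y$ be a reconstructor which is Lipschitz continuous, and suppose that, for a prescribed reconstruction rate $\varepsilon_R(p)$ and a constant $C_2>0$ independent of $p$, $$\mathscr E_{\mathcal R}:=\left(\int_Y\|(\mathcal R\circ\mathcal P)(v)-v\|_Y^2\,d(\mathscr G_\#\mu)(v)\right)^{1/2}\le C_2\,\varepsilon_R(p).$$ Then there exist constants $c_0,c_1,c_2,c_3>0$, which may depend on $m,p$ and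 the fixed data but not on $\eta$ or $N$, such that, with $N_0:=c_0(p+1)\exp(c_1m)$: (i) for every $N\in\mathbb N$ with $N>N_0$ there is a ReLU network $\mathcal A_N:\mathbb R^m\to\mathbb R^p$ with $\mathrm{size}(\mathcal A_N)\le N$ such that the DeepONet $\mathscr N:=\mathcal R\circ\mathcal A_N\circ\mathcal E$ satisfies $$\left(\int_X\|\mathscr G(f)-\mathscr N(f)\|_Y^2\,d\mu(f)\right)^{1/2}\le \operatorname{Lip}(\mathcal R)\left[\frac1{c_1m}\log\left(\frac N{c_0(p+1)}\right)\right]^{-\beta}+\operatorname{Lip}(\mathcal R\circ\mathcal P)\,C_{\mathrm{stab}}|\log\varepsilon_m|^{-\beta}+C_2\,\varepsilon_R(p);$$ (ii) for every $\eta\in(0,1)$ there is a ReLU network $\mathcal A_\eta:\mathbb R^m\to\mathbb R^p$ with $\|\mathcal A_\eta-\mathcal P\circ G\circ\mathcal D\|_{L^2(K,\mathcal E_\#\mu)}\le\eta$ and $$\mathrm{size}(\mathcal A_\eta)\le c_0(p+1)\exp\bigl(c_1m\eta^{-1/\beta}\bigr),\qquad\mathrm{depth}(\mathcal A_\eta)\le c_2+c_3m\eta^{-1/\beta}.$$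
   Context: Convention: $|\log 0|^{-\alpha}:=0$ for $\alpha>0$. $\operatorname{Lip}(\cdot)$ denotes the (smallest) Lipschitz constant; $\#$ denotes pushforward of measures; $\mathbb R^m,\mathbb R^p$ carry Euclidean norms. A reconstructor is an affine map $\mathcal R:\mathbb R^p\to Y$, $\mathcal R(c)=\tau_0+\sum_{k=1}^pc_k\tau_k$ with $\tau_0,\dots,\tau_p\in Y$. ReLU network: a map $\Phi=C_\Lambda\circ\sigma\circ C_{\Lambda-1}\circ\cdots\circ\sigma\circ C_1$ where $\Lambda\ge1$, $\sigma(x)=\max\{x,0\}$ acts componentwise, and $C_\ell(z)=W_\ell z+b_\ell$ are affine maps with $W_\ell\in\mathbb R^{d_{\ell+1}\times d_\ell}$, $b_\ell\in\mathbb R^{d_{\ell+1}}$. With $\|A\|_0$ the number of nonzero entries of a matrix or vector $A$, $\mathrm{size}(\Phi):=\sum_{\ell=1}^{\Lambda}(\|W_\ell\|_0+\|b_\ell\|_0)$ and $\mathrm{depth}(\Phi):=\Lambda-1$ (these refer to a chosen representation of the network). *)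

theory Defs
  imports
    "HOL-Probability.Probability"
    "Jordan_Normal_Form.Matrix"
begin

(* Both HOL-Analysis and Jordan_Normal_Form use the infix $; here it is kept for the
   fixed-dimension vectors real ^ 'n, the other one is written vec_index. *)
no_notation vec_index (infixl "$" 100)

definition Lip :: "('a::metric_space \<Rightarrow> 'b::metric_space) \<Rightarrow> real" where
  "Lip f = Inf {L. L-lipschitz_on UNIV f}"

definition supp :: "'a::topological_space measure \<Rightarrow> 'a set" where
  "supp M = {x. \<forall>U. open U \<and> x \<in> U \<longrightarrow> emeasure M U > 0}"

definition L2fun :: "'a measure \<Rightarrow> ('a \<Rightarrow> 'b::real_normed_vector) \<Rightarrow> bool" where
  "L2fun M f \<longleftrightarrow> f \<in> borel_measurable M \<and> integrable M (\<lambda>x. (norm (f x))\<^sup>2)"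

(* The Bochner integral of a non-integrable function is 0, so an upper bound on L2norm M f
   only carries its usual meaning together with L2fun M f. *)
definition L2norm :: "'a measure \<Rightarrow> ('a \<Rightarrow> 'b::real_normed_vector) \<Rightarrow> real" where
  "L2norm M f = sqrt (\<integral>x. (norm (f x))\<^sup>2 \<partial>M)"

(* |log t|^(-a) for t >= 0, with the convention |log 0|^(-a) = 0. *)
definition log_modulus :: "real \<Rightarrow> real \<Rightarrow> real" where
  "log_modulus a t = (if t = 0 then 0 else \<bar>ln t\<bar> powr (- a))"

definition reconstructor :: "(real ^ 'p \<Rightarrow> 'y::real_vector) \<Rightarrow> bool" where
  "reconstructor R \<longleftrightarrow> (\<exists>t0 t. \<forall>c. R c = t0 + (\<Sum>k\<in>UNIV. (c $ k) *\<^sub>R t k))"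

(* A network is the list of its affine layers (W, b), first layer first. Hidden widths vary
   within a network, hence the matrices with explicit dimensions. *)
type_synonym layer = "real mat \<times> real Matrix.vec"

fun is_net :: "nat \<Rightarrow> layer list \<Rightarrow> nat \<Rightarrow> bool" where
  "is_net d [] d' \<longleftrightarrow> False"
| "is_net d [(W, b)] d' \<longleftrightarrow> W \<in> carrier_mat d' d \<and> b \<in> carrier_vec d'"
| "is_net d ((W, b) # l # ls) d' \<longleftrightarrow>
     (\<exists>k>0. W \<in> carrier_mat k d \<and> b \<in> carrier_vec k \<and> is_net k (l # ls) d')"

definition relu :: "real Matrix.vec \<Rightarrow> real Matrix.vec" where
  "relu = map_vec (\<lambda>t. max t 0)"

fun net_eval :: "layer list \<Rightarrow> real Matrix.vec \<Rightarrow> real Matrix.vec" where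
  "net_eval [] z = z"
| "net_eval [(W, b)] z = W *\<^sub>v z + b"
| "net_eval ((W, b) # l # ls) z = net_eval (l # ls) (relu (W *\<^sub>v z + b))"

definition mat_nnz :: "real mat \<Rightarrow> nat" where
  "mat_nnz W = card {(i, j). i < dim_row W \<and> j < dim_col W \<and> W $$ (i, j) \<noteq> 0}"

definition vec_nnz :: "real Matrix.vec \<Rightarrow> nat" where
  "vec_nnz b = card {i. i < dim_vec b \<and> vec_index b i \<noteq> 0}"

definition net_size :: "layer list \<Rightarrow> nat" where
  "net_size ls = (\<Sum>(W, b)\<leftarrow>ls. mat_nnz W + vec_nnz b)"

definition net_depth :: "layer list \<Rightarrow> nat" where
  "net_depth ls = length ls - 1"

(* to_nat_on UNIV enumerates the finite index type 'n as {0..<CARD('n)}. Which enumeration is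
   used is immaterial: permuting the input or output coordinates only permutes columns of the
   first or rows of the last layer. *)
definition coords :: "real ^ 'n::finite \<Rightarrow> real Matrix.vec" where
  "coords x = Matrix.vec CARD('n) (\<lambda>i. x $ from_nat_into UNIV i)"

definition of_coords :: "real Matrix.vec \<Rightarrow> real ^ 'n::finite" where
  "of_coords v = (\<chi> k. vec_index v (to_nat_on UNIV k))"

definition net_fun :: "layer list \<Rightarrow> real ^ 'm::finite \<Rightarrow> real ^ 'p::finite" where
  "net_fun ls z = of_coords (net_eval ls (coords z))"

end

theory Submission
  imports Defs
begin

text \<open>
  The map \<open>F = P \<circ> G \<circ> D\<close> inherits a logarithmic modulus of continuity on \<open>K\<close>, so on cubes of
  side comparable to \<open>exp (- \<kappa> \<eta> powr (- 1 / \<beta>))\<close> it oscillates by at most \<open>\<eta> / 2\<close>, and \<open>K\<close> is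
  covered by \<open>exp (O (m \<eta> powr (- 1 / \<beta>)))\<close> such cubes. Indicators of half-open cubes are bounded
  pointwise limits of ReLU networks of a fixed architecture with two hidden layers, as the weights
  tend to infinity. Since the error is measured in \<open>L\<^sup>2\<close>, dominated convergence replaces the
  piecewise constant approximation of \<open>F\<close> by a network of the same size; the number of entries of
  dense weight matrices is at most quadratic in the number of cubes, which only affects \<open>c1\<close>.
  The DeepONet bound is (ii) at the accuracy \<open>\<eta>\<close> for which the size bound equals \<open>N\<close>, combined
  with the triangle inequality in \<open>L\<^sup>2\<close>.
\<close>

section \<open>ReLU networks with two hidden layers\<close>

lemma mat_nnz_le: "mat_nnz W \<le> dim_row W * dim_col W"
proof -
  have "mat_nnz W \<le> card ({..<dim_row W} \<times> {..<dim_col W})"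
    unfolding mat_nnz_def by (intro card_mono) auto
  then show ?thesis by simp
qed

lemma vec_nnz_le: "vec_nnz b \<le> dim_vec b"
proof -
  have "vec_nnz b \<le> card {..<dim_vec b}"
    unfolding vec_nnz_def by (intro card_mono) auto
  then show ?thesis by simp
qed

text \<open>Lets neurons be labelled by an arbitrary finite set: \<open>g\<close> enumerates the
  labels, and the matrix product becomes a sum over them.\<close>

lemma mult_mat_vec_reindex:
  assumes "bij_betw g {0..<n} A" and "i < r"
  shows "vec_index (Matrix.mat r n (\<lambda>(i, j). w i (g j)) *\<^sub>v Matrix.vec n (\<lambda>j. f (g j))) i
    = (\<Sum>a\<in>A. w i a * f a)"
proof -
  have "vec_index (Matrix.mat r n (\<lambda>(i, j). w i (g j)) *\<^sub>v Matrix.vec n (\<lambda>j. f (g j))) i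
    = (\<Sum>j\<in>{0..<n}. w i (g j) * f (g j))"
    using assms(2) by (simp add: scalar_prod_def)
  also have "\<dots> = (\<Sum>a\<in>A. w i a * f a)"
    by (rule sum.reindex_bij_betw[OF assms(1)])
  finally show ?thesis .
qed

text \<open>All three layers are treated as dense, so the size bound counts every weight and every
  bias. The label sets have to be nonempty because \<open>is_net\<close> admits only hidden layers
  of positive width.\<close>

lemma two_hidden_layer_network:
  fixes V :: "'a \<Rightarrow> real ^ 'm::finite" and U :: "'b \<Rightarrow> real ^ 'p::finite"
  assumes "finite A" "A \<noteq> {}" "finite B" "B \<noteq> {}"
  obtains ls where "is_net CARD('m) ls CARD('p)" "net_depth ls = 2"
    "net_size ls \<le> card A * (CARD('m) + 1) + card B * (card A + 1) + CARD('p) * (card B + 1)"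
    "\<And>z. net_fun ls z =
       (\<Sum>b\<in>B. max (w b + (\<Sum>a\<in>A. W b a * max (v a + inner (V a) z) 0)) 0 *\<^sub>R U b)"
proof -
  obtain g where g: "bij_betw g {0..<card A} A"
    using ex_bij_betw_nat_finite[OF assms(1)] by blast
  obtain h where h: "bij_betw h {0..<card B} B"
    using ex_bij_betw_nat_finite[OF assms(3)] by blast
  let ?e = "from_nat_into (UNIV :: 'm set)"
  let ?o = "from_nat_into (UNIV :: 'p set)"
  have e: "bij_betw ?e {0..<CARD('m)} UNIV"
    using bij_betw_from_nat_into_finite[of "UNIV :: 'm set"] by (simp add: lessThan_atLeast0)
  let ?W1 = "Matrix.mat (card A) CARD('m) (\<lambda>(i, j). V (g i) $ ?e j)"
  let ?b1 = "Matrix.vec (card A) (\<lambda>i. v (g i))"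
  let ?W2 = "Matrix.mat (card B) (card A) (\<lambda>(i, j). W (h i) (g j))"
  let ?b2 = "Matrix.vec (card B) (\<lambda>i. w (h i))"
  let ?W3 = "Matrix.mat CARD('p) (card B) (\<lambda>(i, j). U (h j) $ ?o i)"
  let ?b3 = "Matrix.vec CARD('p) (\<lambda>i. 0)"
  let ?ls = "[(?W1, ?b1), (?W2, ?b2), (?W3, ?b3)]"
  have cA: "card A > 0" and cB: "card B > 0" using assms by (auto simp: card_gt_0_iff)
  have 1: "is_net CARD('m) ?ls CARD('p)"
    using cA cB by (auto intro!: exI[of _ "card A"] exI[of _ "card B"])
  have 3: "net_size ?ls \<le> card A * (CARD('m) + 1) + card B * (card A + 1) + CARD('p) * (card B + 1)"
    unfolding net_size_def
    using mat_nnz_le[of ?W1] mat_nnz_le[of ?W2] mat_nnz_le[of ?W3]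
      vec_nnz_le[of ?b1] vec_nnz_le[of ?b2] vec_nnz_le[of ?b3] by (simp add: algebra_simps)
  have 4: "net_fun ?ls z =
      (\<Sum>b\<in>B. max (w b + (\<Sum>a\<in>A. W b a * max (v a + inner (V a) z) 0)) 0 *\<^sub>R U b)" for z
  proof -
    let ?y1 = "\<lambda>a. max (v a + inner (V a) z) 0"
    let ?y2 = "\<lambda>b. max (w b + (\<Sum>a\<in>A. W b a * ?y1 a)) 0"
    have y1: "relu (?W1 *\<^sub>v coords z + ?b1) = Matrix.vec (card A) (\<lambda>i. ?y1 (g i))"
    proof (rule eq_vecI)
      fix i assume "i < dim_vec (Matrix.vec (card A) (\<lambda>i. ?y1 (g i)))"
      then have i: "i < card A" by simp
      have "vec_index (?W1 *\<^sub>v coords z) i = inner (V (g i)) z"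
        using mult_mat_vec_reindex[OF e i, of "\<lambda>i k. V (g i) $ k" "\<lambda>k. z $ k"]
        unfolding coords_def by (simp add: inner_vec_def)
      then show "vec_index (relu (?W1 *\<^sub>v coords z + ?b1)) i
          = vec_index (Matrix.vec (card A) (\<lambda>i. ?y1 (g i))) i"
        using i by (simp add: relu_def del: index_mult_mat_vec)
    qed (simp add: relu_def)
    have y2: "relu (?W2 *\<^sub>v Matrix.vec (card A) (\<lambda>i. ?y1 (g i)) + ?b2)
        = Matrix.vec (card B) (\<lambda>i. ?y2 (h i))"
    proof (rule eq_vecI)
      fix i assume "i < dim_vec (Matrix.vec (card B) (\<lambda>i. ?y2 (h i)))"
      then have i: "i < card B" by simp
      show "vec_index (relu (?W2 *\<^sub>v Matrix.vec (card A) (\<lambda>i. ?y1 (g i)) + ?b2)) i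
          = vec_index (Matrix.vec (card B) (\<lambda>i. ?y2 (h i))) i"
        using i mult_mat_vec_reindex[OF g i, of "\<lambda>i. W (h i)" ?y1]
        by (simp add: relu_def del: index_mult_mat_vec)
    qed (simp add: relu_def)
    show ?thesis
    proof (rule Finite_Cartesian_Product.vec_eq_iff[THEN iffD2], rule)
      fix k :: 'p
      have k: "to_nat_on UNIV k < CARD('p)"
        using bij_betw_apply[OF to_nat_on_finite[of "UNIV :: 'p set"]] by auto
      have "net_fun ?ls z $ k = (\<Sum>b\<in>B. U b $ ?o (to_nat_on UNIV k) * ?y2 b)"
        using k mult_mat_vec_reindex[OF h k, of "\<lambda>i b. U b $ ?o i" ?y2]
        by (simp add: net_fun_def of_coords_def y1 y2 del: index_mult_mat_vec)
      then show "net_fun ?ls z $ k = (\<Sum>b\<in>B. ?y2 b *\<^sub>R U b) $ k"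
        by (simp add: mult.commute)
    qed
  qed
  show thesis by (rule that[OF 1 _ 3 4]) (simp add: net_depth_def)
qed

section \<open>Approximate indicators of grid cells\<close>

text \<open>A ramp made of two ReLU neurons: for \<open>M > 0\<close> it climbs from 0 at
  \<open>a - 1 / M\<close> to 1 at \<open>a\<close>. Since it is already 1 at \<open>a\<close>, the
  limit is the indicator of a closed half-line, which is what half-open cells require.\<close>

definition relu_step :: "real \<Rightarrow> real \<Rightarrow> real \<Rightarrow> real" where
  "relu_step M a x = max (M * (x - a) + 1) 0 - max (M * (x - a)) 0"

lemma relu_step_bounds: "0 \<le> relu_step M a x" "relu_step M a x \<le> 1"
  by (auto simp: relu_step_def)

lemma relu_step_tendsto: "(\<lambda>n. relu_step (real n) a x) \<longlonglongrightarrow> of_bool (a \<le> x)"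
proof (cases "a \<le> x")
  case True
  then have "relu_step (real n) a x = 1" for n
    using mult_nonneg_nonneg[of "real n" "x - a"] by (simp add: relu_step_def)
  then show ?thesis using True by simp
next
  case False
  \<comment> \<open>From \<open>n0\<close> on, the ramp starts no earlier than
    \<open>x\<close>.\<close>
  obtain n0 :: nat where n0: "real n0 \<ge> 1 / (a - x)" using real_arch_simple by blast
  have "relu_step (real n) a x = 0" if "n \<ge> n0" for n
  proof -
    have "real n \<ge> 1 / (a - x)" using n0 that by (meson of_nat_mono order_trans)
    then have "real n * (a - x) \<ge> 1" using False by (simp add: field_simps)
    then have "real n * (x - a) \<le> -1" by (simp add: algebra_simps)
    then show ?thesis by (simp add: relu_step_def)
  qed
  then have "\<forall>\<^sub>F n in sequentially. relu_step (real n) a x = 0"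
    by (auto simp: eventually_sequentially)
  then show ?thesis using False by (simp add: tendsto_eventually)
qed

definition grid_cell :: "real \<Rightarrow> real ^ 'm \<Rightarrow> 'm \<Rightarrow> int" where
  "grid_cell \<delta> x i = \<lfloor>x $ i / \<delta>\<rfloor>"

text \<open>A conjunction by thresholding: in the limit each coordinate contributes 1 if it lies in
  its interval and 0 otherwise, and after subtracting \<open>CARD('m) - 1\<close> only a point with
  all coordinates inside keeps a positive value. No products are formed, and each cell costs one
  second-layer neuron.\<close>

definition cell_bump :: "real \<Rightarrow> real \<Rightarrow> ('m::finite \<Rightarrow> int) \<Rightarrow> real ^ 'm \<Rightarrow> real" where
  "cell_bump M \<delta> k x = max (1 - real CARD('m) +
     (\<Sum>i\<in>UNIV. relu_step M (\<delta> * k i) (x $ i) - relu_step M (\<delta> * (k i + 1)) (x $ i))) 0"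

lemma cell_bump_bounds: "0 \<le> cell_bump M \<delta> k x" "cell_bump M \<delta> k x \<le> 1"
  for k :: "'m::finite \<Rightarrow> int"
proof -
  have "(\<Sum>i\<in>UNIV. relu_step M (\<delta> * k i) (x $ i) - relu_step M (\<delta> * (k i + 1)) (x $ i))
      \<le> (\<Sum>i\<in>(UNIV :: 'm set). 1)"
    using relu_step_bounds by (intro sum_mono) (smt (verit))
  then show "cell_bump M \<delta> k x \<le> 1" by (simp add: cell_bump_def)
qed (simp add: cell_bump_def)

lemma cell_bump_tendsto:
  fixes k :: "'m::finite \<Rightarrow> int"
  assumes "\<delta> > 0"
  shows "(\<lambda>n. cell_bump (real n) \<delta> k x) \<longlonglongrightarrow> of_bool (grid_cell \<delta> x = k)"
proof -
  \<comment> \<open>The difference of two nested closed half-lines is a half-open interval, exactly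
    the set where the floor equals \<open>k i\<close>.\<close>
  have cell: "of_bool (\<delta> * k i \<le> x $ i) - of_bool (\<delta> * (k i + 1) \<le> x $ i)
      = (of_bool (grid_cell \<delta> x i = k i) :: real)" for i
  proof -
    have "grid_cell \<delta> x i = k i \<longleftrightarrow> \<delta> * k i \<le> x $ i \<and> x $ i < \<delta> * (k i + 1)"
      using assms by (simp add: grid_cell_def floor_eq_iff field_simps)
    moreover have "\<delta> * k i \<le> \<delta> * (k i + 1)" using assms by simp
    ultimately show ?thesis by auto
  qed
  have "(\<lambda>n. cell_bump (real n) \<delta> k x) \<longlonglongrightarrow> max (1 - real CARD('m) +
     (\<Sum>i\<in>UNIV. of_bool (\<delta> * k i \<le> x $ i) - of_bool (\<delta> * (k i + 1) \<le> x $ i))) 0"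
    unfolding cell_bump_def by (intro tendsto_intros relu_step_tendsto)
  also have "max (1 - real CARD('m) +
     (\<Sum>i\<in>UNIV. of_bool (\<delta> * k i \<le> x $ i) - of_bool (\<delta> * (k i + 1) \<le> x $ i))) 0
     = of_bool (grid_cell \<delta> x = k)"
  proof (cases "grid_cell \<delta> x = k")
    case True
    then show ?thesis unfolding cell by simp
  next
    case False
    \<comment> \<open>A single missed coordinate bounds the sum by \<open>CARD('m) - 1\<close>, so
      the threshold cuts the value to 0.\<close>
    then obtain j where j: "grid_cell \<delta> x j \<noteq> k j" by blast
    have "(\<Sum>i\<in>UNIV. of_bool (grid_cell \<delta> x i = k i) :: real)
        \<le> (\<Sum>i\<in>UNIV. of_bool (i \<noteq> j))"
      using j by (intro sum_mono) auto
    also have "\<dots> = real CARD('m) - 1"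
    proof -
      have "(\<Sum>i\<in>(UNIV :: 'm set). of_bool (i \<noteq> j) :: real) = (\<Sum>i\<in>UNIV. 1 - of_bool (i = j))"
        by (intro sum.cong) auto
      also have "\<dots> = real CARD('m) - 1" by (simp add: sum_subtractf of_bool_def)
      finally show ?thesis .
    qed
    finally show ?thesis unfolding cell using False by simp
  qed
  finally show ?thesis .
qed

lemma continuous_on_cell_bump: "continuous_on S (cell_bump M \<delta> k)"
  unfolding cell_bump_def relu_step_def
  by (intro continuous_intros)

lemma box_eq_PiE: "{k. \<forall>i. \<bar>k i\<bar> \<le> int q} = PiE UNIV (\<lambda>_. {- int q..int q})"
proof -
  have "\<bar>x\<bar> \<le> int q \<longleftrightarrow> x \<in> {- int q..int q}" for x by auto
  then show ?thesis by (simp only: PiE_UNIV_domain Pi_def) simp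
qed

lemma finite_box: "finite {k :: 'm::finite \<Rightarrow> int. \<forall>i. \<bar>k i\<bar> \<le> int q}"
  unfolding box_eq_PiE by (intro finite_PiE) auto

lemma card_box: "card {k :: 'm::finite \<Rightarrow> int. \<forall>i. \<bar>k i\<bar> \<le> int q} = (2 * q + 1) ^ CARD('m)"
proof -
  have "card {- int q..int q} = 2 * q + 1" by simp
  then show ?thesis unfolding box_eq_PiE by (subst card_PiE) (simp_all del: card_atLeastAtMost_int)
qed

text \<open>All cells share one first layer of ramps. The dense second matrix has
  \<open>card ?A * card ?B\<close> entries, which is of order
  \<open>(2 * q + 2) ^ (CARD('m) + 1)\<close>; the exponent \<open>2 * CARD('m)\<close> covers it
  for every dimension.\<close>

lemma grid_network:
  fixes U :: "('m::finite \<Rightarrow> int) \<Rightarrow> real ^ 'p::finite" and q :: nat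
  obtains ls where "is_net CARD('m) ls CARD('p)" "net_depth ls = 2"
    "net_size ls \<le> 9 * CARD('m)\<^sup>2 * (CARD('p) + 1) * (2 * q + 2) ^ (2 * CARD('m))"
    "\<And>z. net_fun ls z = (\<Sum>k | \<forall>i. \<bar>k i\<bar> \<le> int q. cell_bump M \<delta> k z *\<^sub>R U k)"
proof -
  \<comment> \<open>A first-layer neuron is a coordinate, a grid level and a flag for one of the two
    ReLUs of a ramp. Levels run up to \<open>q + 1\<close> because cell \<open>k\<close> also needs
    the right end point \<open>k i + 1\<close>.\<close>
  let ?A = "(UNIV :: 'm set) \<times> {- int q..int q + 1} \<times> (UNIV :: bool set)"
  let ?B = "{k :: 'm \<Rightarrow> int. \<forall>i. \<bar>k i\<bar> \<le> int q}"
  let ?m = "CARD('m)" and ?p = "CARD('p)"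
  let ?s = "2 * q + 2"
  note finB = finite_box[of q] and cardB = card_box[of q]
  have neB: "?B \<noteq> {}" by (auto intro!: exI[of _ "\<lambda>_. 0"])
  have cardA: "card ?A = 2 * ?m * ?s"
  proof -
    have "card {- int q..int q + 1} = 2 * q + 2" by simp
    then show ?thesis by (simp add: card_cartesian_product del: card_atLeastAtMost_int)
  qed
  define V where "V = (\<lambda>(i :: 'm, j :: int, t :: bool). axis i M)"
  define v where "v = (\<lambda>(i :: 'm, j :: int, t :: bool). of_bool t - M * (\<delta> * j))"
  define w where "w = (\<lambda>k :: 'm \<Rightarrow> int. 1 - real ?m)"
  \<comment> \<open>Cell \<open>k\<close> adds the ramp at its lower face and subtracts the one at
    its upper face; the flag carries the sign inside each ramp.\<close>
  define W where "W = (\<lambda>(k :: 'm \<Rightarrow> int) (i :: 'm, j :: int, t :: bool).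
     (if j = k i then (if t then 1 else -1) else 0) - (if j = k i + 1 then (if t then 1 else -1) else 0 :: real))"
  obtain ls where ls: "is_net ?m ls ?p" "net_depth ls = 2"
    "net_size ls \<le> card ?A * (?m + 1) + card ?B * (card ?A + 1) + ?p * (card ?B + 1)"
    "\<And>z. net_fun ls z =
       (\<Sum>k\<in>?B. max (w k + (\<Sum>a\<in>?A. W k a * max (v a + inner (V a) z) 0)) 0 *\<^sub>R U k)"
    by (rule two_hidden_layer_network[of ?A ?B w W v V U]) (use finB neB in auto)
  have "(\<Sum>a\<in>?A. W k a * max (v a + inner (V a) z) 0) =
     (\<Sum>i\<in>UNIV. relu_step M (\<delta> * k i) (z $ i) - relu_step M (\<delta> * (k i + 1)) (z $ i))"
    if k: "k \<in> ?B" for k z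
  proof -
    have "(\<Sum>a\<in>?A. W k a * max (v a + inner (V a) z) 0)
      = (\<Sum>i\<in>UNIV. \<Sum>j\<in>{- int q..int q + 1}. \<Sum>t\<in>UNIV. W k (i, j, t) * max (v (i, j, t) + inner (V (i, j, t)) z) 0)"
      by (simp add: sum.cartesian_product split_def)
    also have "\<dots> = (\<Sum>i\<in>UNIV. \<Sum>j\<in>{- int q..int q + 1}.
        (if j = k i then relu_step M (\<delta> * j) (z $ i) else 0)
        - (if j = k i + 1 then relu_step M (\<delta> * j) (z $ i) else 0))"
      by (intro sum.cong refl)
        (auto simp: UNIV_bool W_def v_def V_def relu_step_def inner_axis' algebra_simps)
    also have "\<dots> = (\<Sum>i\<in>UNIV. relu_step M (\<delta> * k i) (z $ i) - relu_step M (\<delta> * (k i + 1)) (z $ i))"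
    proof (rule sum.cong)
      fix i
      have "- int q \<le> k i" "k i \<le> int q" using k by (auto simp: abs_le_iff minus_le_iff)
      then show "(\<Sum>j\<in>{- int q..int q + 1}. (if j = k i then relu_step M (\<delta> * j) (z $ i) else 0)
        - (if j = k i + 1 then relu_step M (\<delta> * j) (z $ i) else 0))
        = relu_step M (\<delta> * k i) (z $ i) - relu_step M (\<delta> * (k i + 1)) (z $ i)"
        by (simp add: sum_subtractf)
    qed simp
    finally show ?thesis .
  qed
  then have eval: "net_fun ls z = (\<Sum>k\<in>?B. cell_bump M \<delta> k z *\<^sub>R U k)" for z
    unfolding ls(4) by (intro sum.cong) (simp_all add: cell_bump_def w_def)
  have m: "?m \<ge> 1" by (simp add: Suc_leI)
  \<comment> \<open>A common bound for the entry counts of all layers;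
    \<open>CARD('m) \<ge> 1\<close> enters through
    \<open>CARD('m) + 1 \<le> 2 * CARD('m)\<close>.\<close>
  define S where "S = ?s ^ (2 * ?m)"
  have s1: "1 \<le> S" by (simp add: S_def)
  have s2: "?s \<le> S"
    using power_increasing[of 1 "2 * ?m" ?s] m by (simp add: S_def)
  have s3: "card ?B * ?s \<le> S"
  proof -
    have "card ?B * ?s \<le> ?s ^ ?m * ?s ^ 1"
      unfolding cardB by (intro mult_mono power_mono) auto
    also have "\<dots> \<le> ?s ^ ?m * ?s ^ ?m"
      using m by (intro mult_left_mono power_increasing) auto
    finally show ?thesis by (simp add: S_def power_add[symmetric] mult_2)
  qed
  have s4: "card ?B \<le> S"
  proof -
    have "card ?B * 1 \<le> card ?B * ?s" by (intro mult_le_mono2) simp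
    then show ?thesis using s3 by linarith
  qed
  have "net_size ls \<le> 2 * ?m * (?m + 1) * ?s + (2 * ?m * (card ?B * ?s) + card ?B) + ?p * (card ?B + 1)"
    using ls(3) unfolding cardA by (simp add: algebra_simps)
  also have "\<dots> \<le> 2 * ?m * (?m + 1) * S + (2 * ?m * S + S) + ?p * (S + S)"
    using s1 s2 s3 s4 by (intro add_mono mult_left_mono) auto
  also have "\<dots> = (2 * ?m\<^sup>2 + 4 * ?m + 1 + 2 * ?p) * S"
    by (simp add: algebra_simps power2_eq_square)
  also have "\<dots> \<le> (9 * ?m\<^sup>2 * (?p + 1)) * S"
  proof (intro mult_right_mono)
    have "?m \<le> ?m\<^sup>2" using m by (simp add: power2_eq_square)
    moreover have "?p \<le> ?m\<^sup>2 * ?p" using m by simp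
    ultimately have "2 * ?m\<^sup>2 + 4 * ?m + 1 + 2 * ?p \<le> 9 * ?m\<^sup>2 + 9 * (?m\<^sup>2 * ?p)"
      using m by linarith
    then show "2 * ?m\<^sup>2 + 4 * ?m + 1 + 2 * ?p \<le> 9 * ?m\<^sup>2 * (?p + 1)"
      by (simp add: algebra_simps)
  qed simp
  finally have "net_size ls \<le> 9 * ?m\<^sup>2 * (?p + 1) * ?s ^ (2 * ?m)" unfolding S_def .
  then show thesis by (rule that[OF ls(1,2) _ eval])
qed

text \<open>The step function built from sample values is within \<open>\<epsilon>\<close> of
  \<open>F\<close> on \<open>K\<close>, and the mass is at most 1. The strict gap
  \<open>\<epsilon> < \<eta>\<close> is what allows a network of finite steepness to replace the
  limit.\<close>

lemma grid_network_L2_approx: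
  fixes F :: "real ^ 'm::finite \<Rightarrow> real ^ 'p::finite" and q :: nat
  assumes \<delta>: "\<delta> > 0" and \<epsilon>: "0 \<le> \<epsilon>" "\<epsilon> < \<eta>"
    and K: "\<And>z i. z \<in> K \<Longrightarrow> \<bar>z $ i\<bar> \<le> real q * \<delta>"
    and "finite_measure \<nu>" and sets: "sets \<nu> = sets (restrict_space borel K)"
    and mass: "measure \<nu> (space \<nu>) \<le> 1"
    and F: "F \<in> borel_measurable \<nu>" and bdd: "\<And>z. z \<in> K \<Longrightarrow> norm (F z) \<le> b"
    and osc: "\<And>x y. x \<in> K \<Longrightarrow> y \<in> K \<Longrightarrow> (\<And>i. \<bar>x $ i - y $ i\<bar> \<le> \<delta>) \<Longrightarrow> norm (F x - F y) \<le> \<epsilon>"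
  obtains A where "is_net CARD('m) A CARD('p)" "net_depth A = 2"
    "net_size A \<le> 9 * CARD('m)\<^sup>2 * (CARD('p) + 1) * (2 * q + 2) ^ (2 * CARD('m))"
    "continuous_on UNIV (net_fun A :: real ^ 'm \<Rightarrow> real ^ 'p)"
    "L2fun \<nu> (\<lambda>z. net_fun A z - F z)" "L2norm \<nu> (\<lambda>z. net_fun A z - F z) \<le> \<eta>"
proof -
  interpret finite_measure \<nu> by fact
  note [measurable_cong] = sets
  have space: "space \<nu> = K" using sets_eq_imp_space_eq[OF sets] by (simp add: space_restrict_space)
  let ?B = "{k :: 'm \<Rightarrow> int. \<forall>i. \<bar>k i\<bar> \<le> int q}"
  note finB = finite_box[of q]
  define U where "U k = (if \<exists>x\<in>K. grid_cell \<delta> x = k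
      then F (SOME x. x \<in> K \<and> grid_cell \<delta> x = k) else 0)" for k
  have U: "\<exists>x\<in>K. grid_cell \<delta> x = grid_cell \<delta> z \<and> U (grid_cell \<delta> z) = F x" if "z \<in> K" for z
  proof -
    have "\<exists>x. x \<in> K \<and> grid_cell \<delta> x = grid_cell \<delta> z" using that by blast
    from someI_ex[OF this] show ?thesis using that unfolding U_def by auto
  qed
  have Ub: "norm (U k) \<le> \<bar>b\<bar>" for k
  proof (cases "\<exists>x\<in>K. grid_cell \<delta> x = k")
    case True
    then obtain z where "z \<in> K" "k = grid_cell \<delta> z" by blast
    then show ?thesis using U[of z] bdd by (metis abs_ge_self order_trans)
  qed (simp add: U_def)
  have UF: "norm (U (grid_cell \<delta> z) - F z) \<le> \<epsilon>" if z: "z \<in> K" for z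
  proof -
    obtain x where x: "x \<in> K" "grid_cell \<delta> x = grid_cell \<delta> z" "U (grid_cell \<delta> z) = F x"
      using U[OF z] by blast
    have "\<bar>x $ i - z $ i\<bar> \<le> \<delta>" for i
    proof -
      have "\<lfloor>x $ i / \<delta>\<rfloor> = \<lfloor>z $ i / \<delta>\<rfloor>"
        using fun_cong[OF x(2), of i] by (simp add: grid_cell_def)
      then have "\<bar>x $ i / \<delta> - z $ i / \<delta>\<bar> \<le> 1" by linarith
      then show ?thesis using \<delta> by (simp add: abs_le_iff field_simps)
    qed
    then show ?thesis using osc[OF x(1) z] x(3) by simp
  qed
  \<comment> \<open>The index \<open>q\<close> itself occurs, for points with
    \<open>z $ i = real q * \<delta>\<close>, so the box of indices is closed at both ends.\<close>
  have cellB: "grid_cell \<delta> z \<in> ?B" if "z \<in> K" for z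
  proof -
    have "\<bar>\<lfloor>z $ i / \<delta>\<rfloor>\<bar> \<le> int q" for i
    proof -
      have "z $ i / \<delta> \<le> real q" "- real q \<le> z $ i / \<delta>"
        using K[OF that, of i] \<delta> by (auto simp: abs_le_iff field_simps)
      then have "\<lfloor>z $ i / \<delta>\<rfloor> \<le> int q" "- int q \<le> \<lfloor>z $ i / \<delta>\<rfloor>" by linarith+
      then show ?thesis by linarith
    qed
    then show ?thesis by (simp add: grid_cell_def)
  qed
  have "\<forall>n::nat. \<exists>A. is_net CARD('m) A CARD('p) \<and> net_depth A = 2 \<and>
    net_size A \<le> 9 * CARD('m)\<^sup>2 * (CARD('p) + 1) * (2 * q + 2) ^ (2 * CARD('m)) \<and>
    (\<forall>z. net_fun A z = (\<Sum>k\<in>?B. cell_bump (real n) \<delta> k z *\<^sub>R U k))"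
  proof
    fix n :: nat
    show "\<exists>A. is_net CARD('m) A CARD('p) \<and> net_depth A = 2 \<and>
      net_size A \<le> 9 * CARD('m)\<^sup>2 * (CARD('p) + 1) * (2 * q + 2) ^ (2 * CARD('m)) \<and>
      (\<forall>z. net_fun A z = (\<Sum>k\<in>?B. cell_bump (real n) \<delta> k z *\<^sub>R U k))"
      by (rule grid_network[of q "real n" \<delta> U]) blast
  qed
  from choice[OF this] obtain A where A: "\<And>n. is_net CARD('m) (A n) CARD('p)" "\<And>n. net_depth (A n) = 2"
    "\<And>n. net_size (A n) \<le> 9 * CARD('m)\<^sup>2 * (CARD('p) + 1) * (2 * q + 2) ^ (2 * CARD('m))"
    "\<And>n z. net_fun (A n) z = (\<Sum>k\<in>?B. cell_bump (real n) \<delta> k z *\<^sub>R U k)"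
    by blast
  have cont: "continuous_on UNIV (net_fun (A n) :: real ^ 'm \<Rightarrow> real ^ 'p)" for n
    unfolding A(4)[abs_def] by (intro continuous_intros continuous_on_cell_bump)
  have meas: "(net_fun (A n) :: real ^ 'm \<Rightarrow> real ^ 'p) \<in> borel_measurable \<nu>" for n
    using measurable_restrict_space1[OF borel_measurable_continuous_onI[OF cont]]
      measurable_cong_sets[OF sets refl] by blast
  define f where "f n z = net_fun (A n) z - F z" for n z
  have f_meas [measurable]: "f n \<in> borel_measurable \<nu>" for n
    unfolding f_def using meas F by simp
  \<comment> \<open>Measurability of the step function is inherited from the networks as their
    pointwise limit on \<open>K\<close>, the whole space of \<open>\<nu>\<close>.\<close>
  have U_meas: "(\<lambda>z. U (grid_cell \<delta> z)) \<in> borel_measurable \<nu>"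
    if "\<And>z. z \<in> K \<Longrightarrow> (\<lambda>n. net_fun (A n) z) \<longlonglongrightarrow> U (grid_cell \<delta> z)"
    using that space by (intro borel_measurable_LIMSEQ_metric[OF meas]) auto
  have lim: "(\<lambda>n. net_fun (A n) z) \<longlonglongrightarrow> U (grid_cell \<delta> z)" if "z \<in> K" for z
  proof -
    have "(\<lambda>n. net_fun (A n) z) \<longlonglongrightarrow> (\<Sum>k\<in>?B. of_bool (grid_cell \<delta> z = k) *\<^sub>R U k)"
      unfolding A(4) by (intro tendsto_intros cell_bump_tendsto \<delta>)
    also have "(\<Sum>k\<in>?B. of_bool (grid_cell \<delta> z = k) *\<^sub>R U k)
        = (\<Sum>k\<in>?B. if grid_cell \<delta> z = k then U k else 0)"
      by (intro sum.cong) auto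
    also have "\<dots> = U (grid_cell \<delta> z)"
      using cellB[OF that] by (subst sum.delta'[OF finB]) simp
    finally show ?thesis .
  qed
  \<comment> \<open>The dominating constant: every bump is at most 1, so the network is bounded by
    the first summand and \<open>F\<close> by the second, uniformly in the steepness
    \<open>n\<close>.\<close>
  define w where "w = real (card ?B) * \<bar>b\<bar> + \<bar>b\<bar>"
  have fb: "norm (f n z) \<le> w" if "z \<in> K" for n z
  proof -
    have "norm (net_fun (A n) z :: real ^ 'p) \<le> (\<Sum>k\<in>?B. \<bar>b\<bar>)"
      unfolding A(4)
    proof (intro sum_norm_le)
      fix k
      have "norm (cell_bump (real n) \<delta> k z *\<^sub>R U k) \<le> 1 * \<bar>b\<bar>"
        unfolding norm_scaleR using cell_bump_bounds[of "real n" \<delta> k z] Ub[of k] by (intro mult_mono) auto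
      then show "norm (cell_bump (real n) \<delta> k z *\<^sub>R U k) \<le> \<bar>b\<bar>" by simp
    qed
    moreover have "norm (F z) \<le> \<bar>b\<bar>" using bdd[OF that] by linarith
    ultimately show ?thesis
      unfolding f_def w_def using norm_triangle_ineq4[of "net_fun (A n) z" "F z"] by simp
  qed
  have fb2: "AE z in \<nu>. norm ((norm (f n z))\<^sup>2) \<le> w\<^sup>2" for n
    using fb space by (intro AE_I2) (auto intro!: power_mono)
  have f_int: "integrable \<nu> (\<lambda>z. (norm (f n z))\<^sup>2)" for n
    by (rule integrable_const_bound[OF fb2]) measurable
  have "(\<lambda>n. \<integral>z. (norm (f n z))\<^sup>2 \<partial>\<nu>) \<longlonglongrightarrow> (\<integral>z. (norm (U (grid_cell \<delta> z) - F z))\<^sup>2 \<partial>\<nu>)"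
  proof (rule integral_dominated_convergence[where w = "\<lambda>_. w\<^sup>2"])
    show "AE z in \<nu>. (\<lambda>n. (norm (f n z))\<^sup>2) \<longlonglongrightarrow> (norm (U (grid_cell \<delta> z) - F z))\<^sup>2"
      unfolding f_def using space lim by (intro AE_I2 tendsto_intros) auto
    show "(\<lambda>z. (norm (U (grid_cell \<delta> z) - F z))\<^sup>2) \<in> borel_measurable \<nu>"
      using U_meas[OF lim] F by simp
  qed (use fb2 in simp_all)
  moreover have "(\<integral>z. (norm (U (grid_cell \<delta> z) - F z))\<^sup>2 \<partial>\<nu>) < \<eta>\<^sup>2"
  proof -
    have "(\<integral>z. (norm (U (grid_cell \<delta> z) - F z))\<^sup>2 \<partial>\<nu>) \<le> (\<integral>z. \<epsilon>\<^sup>2 \<partial>\<nu>)"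
      using UF space by (intro integral_mono') (auto intro!: power_mono)
    also have "\<dots> = \<epsilon>\<^sup>2 * measure \<nu> (space \<nu>)" by simp
    also have "\<dots> \<le> \<epsilon>\<^sup>2" using mass by (simp add: mult_left_le)
    also have "\<dots> < \<eta>\<^sup>2" using \<epsilon> by (intro power_strict_mono) auto
    finally show ?thesis .
  qed
  ultimately have "\<forall>\<^sub>F n in sequentially. (\<integral>z. (norm (f n z))\<^sup>2 \<partial>\<nu>) < \<eta>\<^sup>2"
    by (rule order_tendstoD)
  then obtain n where n: "(\<integral>z. (norm (f n z))\<^sup>2 \<partial>\<nu>) < \<eta>\<^sup>2"
    by (meson eventually_happens' sequentially_bot)
  have "L2norm \<nu> (\<lambda>z. net_fun (A n) z - F z) \<le> \<eta>"
    using n \<epsilon> unfolding L2norm_def f_def by (intro real_le_lsqrt) auto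
  moreover have "L2fun \<nu> (\<lambda>z. net_fun (A n) z - F z)"
    using f_meas[of n] f_int[of n] unfolding L2fun_def f_def by simp
  ultimately show thesis using that[OF A(1,2,3) cont] by blast
qed

section \<open>Logarithmic moduli of continuity\<close>

text \<open>\<open>\<bar>ln t\<bar>\<close> decreases on \<open>(0, 1)\<close> and the exponent is
  nonpositive; the convention at 0 supplies the smallest value.\<close>

lemma log_modulus_mono:
  assumes "0 \<le> s" "s \<le> t" "t < 1" "0 \<le> a"
  shows "log_modulus a s \<le> log_modulus a t"
proof (cases "s = 0")
  case True
  then show ?thesis by (simp add: log_modulus_def)
next
  case False
  then have "0 < s" "0 < t" using assms by auto
  then have "\<bar>ln t\<bar> > 0" "\<bar>ln t\<bar> \<le> \<bar>ln s\<bar>" using assms by auto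
  then have "\<bar>ln s\<bar> powr (- a) \<le> \<bar>ln t\<bar> powr (- a)"
    using assms(4) by (intro powr_mono2') auto
  then show ?thesis using \<open>0 < s\<close> \<open>0 < t\<close> by (simp add: log_modulus_def)
qed

text \<open>The constants come out as \<open>c1 = 2 * \<kappa>\<close> and
  \<open>c0 = 9 * m\<^sup>2 * H ^ (2 * m)\<close> with \<open>m = CARD('m)\<close>; both are fixed
  before \<open>\<eta>\<close> is.\<close>

lemma log_modulus_network_approx:
  fixes F :: "real ^ 'm::finite \<Rightarrow> real ^ 'p::finite"
  assumes "compact K" "continuous_on K F"
    and "0 < \<beta>" "0 < C" "0 < L" "0 < \<tau>" "\<tau> < 1"
    and modulus: "\<And>x y. x \<in> K \<Longrightarrow> y \<in> K \<Longrightarrow> L * norm (x - y) \<le> \<tau> \<Longrightarrow>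
       norm (F x - F y) \<le> C * log_modulus \<beta> (L * norm (x - y))"
    and \<nu>: "finite_measure \<nu>" "sets \<nu> = sets (restrict_space borel K)"
      "measure \<nu> (space \<nu>) \<le> 1"
  obtains c0 c1 where "c0 > 0" "c1 > 0"
    "\<And>\<eta>. 0 < \<eta> \<Longrightarrow> \<eta> < 1 \<Longrightarrow>
      \<exists>A. is_net CARD('m) A CARD('p) \<and> net_depth A = 2 \<and>
        continuous_on UNIV (net_fun A :: real ^ 'm \<Rightarrow> real ^ 'p) \<and>
        L2fun \<nu> (\<lambda>z. net_fun A z - F z) \<and> L2norm \<nu> (\<lambda>z. net_fun A z - F z) \<le> \<eta> \<and>
        real (net_size A) \<le> c0 * (real CARD('p) + 1) * exp (c1 * real CARD('m) * \<eta> powr (- 1 / \<beta>))"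
proof -
  let ?m = "real CARD('m)"
  obtain b where b: "\<And>z. z \<in> K \<Longrightarrow> norm (F z) \<le> b"
    using compact_imp_bounded[OF compact_continuous_image[OF assms(2,1)]]
    by (auto simp: bounded_iff)
  obtain r where r: "r > 0" "\<And>z. z \<in> K \<Longrightarrow> norm z \<le> r"
    using compact_imp_bounded[OF assms(1)] by (auto simp: bounded_pos)
  have F_meas: "F \<in> borel_measurable \<nu>"
    using borel_measurable_continuous_on_restrict[OF assms(2)] measurable_cong_sets[OF \<nu>(2) refl]
    by blast
  \<comment> \<open>The first entry brings the modulus at scale \<open>s\<close> below
    \<open>\<eta> / 2\<close>, the second keeps \<open>s \<le> \<tau>\<close>, the range in which
    the modulus is assumed.\<close>
  define \<kappa> where "\<kappa> = max ((2 * C) powr (1 / \<beta>)) (- ln \<tau>)"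
  have \<kappa>: "\<kappa> > 0" "(2 * C) powr (1 / \<beta>) \<le> \<kappa>" "- ln \<tau> \<le> \<kappa>"
    using \<open>0 < C\<close> by (auto simp: \<kappa>_def less_max_iff_disj)
  \<comment> \<open>Chosen for the bound on \<open>2 * q + 2\<close> below: the first summand comes
    from \<open>2 * r / \<delta>\<close>, the 4 from rounding up \<open>q\<close>.\<close>
  define H where "H = 2 * r * L * ?m + 4"
  have H: "H > 0" using r \<open>0 < L\<close> by (simp add: H_def add_pos_pos)
  have "\<exists>A. is_net CARD('m) A CARD('p) \<and> net_depth A = 2 \<and>
        continuous_on UNIV (net_fun A :: real ^ 'm \<Rightarrow> real ^ 'p) \<and>
        L2fun \<nu> (\<lambda>z. net_fun A z - F z) \<and> L2norm \<nu> (\<lambda>z. net_fun A z - F z) \<le> \<eta> \<and>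
        real (net_size A) \<le> (9 * ?m\<^sup>2 * H ^ (2 * CARD('m))) * (real CARD('p) + 1)
           * exp (2 * \<kappa> * ?m * \<eta> powr (- 1 / \<beta>))"
    if \<eta>: "0 < \<eta>" "\<eta> < 1" for \<eta>
  proof -
    define T where "T = \<eta> powr (- 1 / \<beta>)"
    have T: "T \<ge> 1"
      using \<eta> \<open>0 < \<beta>\<close> powr_mono'[of "- 1 / \<beta>" 0 \<eta>] by (simp add: T_def)
    have T\<beta>: "T powr (- \<beta>) = \<eta>"
      using \<eta> \<open>0 < \<beta>\<close> by (simp add: T_def powr_powr)
    \<comment> \<open>At this scale the logarithm is \<open>- \<kappa> * T\<close>, so the modulus
      becomes a multiple of \<open>T powr (- \<beta>) = \<eta>\<close>.\<close>
    define s where "s = exp (- (\<kappa> * T))"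
    have "\<kappa> * 1 \<le> \<kappa> * T" using \<kappa> T by (intro mult_left_mono) auto
    then have "s \<le> exp (ln \<tau>)" unfolding s_def using \<kappa> by (subst exp_le_cancel_iff) linarith
    then have s: "0 < s" "s \<le> \<tau>" using \<open>0 < \<tau>\<close> by (simp_all add: s_def)
    have "C * log_modulus \<beta> s \<le> \<eta> / 2"
    proof -
      have "log_modulus \<beta> s = (\<kappa> * T) powr (- \<beta>)"
        using \<kappa> T by (simp add: log_modulus_def s_def)
      also have "\<dots> = \<kappa> powr (- \<beta>) * \<eta>"
        using \<kappa> T T\<beta> by (simp add: powr_mult)
      also have "\<dots> \<le> ((2 * C) powr (1 / \<beta>)) powr (- \<beta>) * \<eta>"
        using \<kappa> \<open>0 < \<beta>\<close> \<open>0 < C\<close> \<eta> by (intro mult_right_mono powr_mono2') auto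
      also have "\<dots> = \<eta> / (2 * C)"
        using \<open>0 < \<beta>\<close> \<open>0 < C\<close> by (simp add: powr_powr powr_minus field_simps)
      finally show ?thesis using \<open>0 < C\<close> by (simp add: field_simps)
    qed
    \<comment> \<open>Points whose coordinates differ by at most \<open>\<delta>\<close> are at
      \<open>l\<^sup>1\<close> distance at most \<open>m * \<delta> = s / L\<close>, where
      \<open>m\<close> is the dimension; this also bounds the Euclidean distance.\<close>
    define \<delta> where "\<delta> = s / (L * ?m)"
    have \<delta>: "\<delta> > 0" using s \<open>0 < L\<close> by (simp add: \<delta>_def)
    define q where "q = nat \<lceil>r / \<delta>\<rceil>"
    have q: "r / \<delta> \<le> real q" "real q \<le> r / \<delta> + 1"
      using r \<delta> by (auto simp: q_def)
    have osc: "norm (F x - F y) \<le> \<eta> / 2"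
      if xy: "x \<in> K" "y \<in> K" "\<And>i. \<bar>x $ i - y $ i\<bar> \<le> \<delta>" for x y
    proof -
      have "norm (x - y) \<le> (\<Sum>i\<in>UNIV. \<bar>(x - y) $ i\<bar>)" by (rule norm_le_l1_cart)
      also have "\<dots> \<le> (\<Sum>i\<in>(UNIV :: 'm set). \<delta>)" using xy(3) by (intro sum_mono) simp
      also have "\<dots> = s / L" by (simp add: \<delta>_def)
      finally have le: "L * norm (x - y) \<le> s" using \<open>0 < L\<close> by (simp add: field_simps)
      then have "norm (F x - F y) \<le> C * log_modulus \<beta> (L * norm (x - y))"
        using s by (intro modulus xy) simp
      also have "\<dots> \<le> C * log_modulus \<beta> s"
        using le s \<open>0 < L\<close> \<open>0 < C\<close> \<open>\<tau> < 1\<close> \<open>0 < \<beta>\<close>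
        by (intro mult_left_mono log_modulus_mono) auto
      finally show ?thesis using \<open>C * log_modulus \<beta> s \<le> \<eta> / 2\<close> by simp
    qed
    have box: "\<bar>z $ i\<bar> \<le> real q * \<delta>" if "z \<in> K" for z i
    proof -
      have "\<bar>z $ i\<bar> \<le> r"
        using r(2)[OF that] component_le_norm_cart[of z i] by simp
      also have "r \<le> real q * \<delta>" using q(1) \<delta> by (simp add: field_simps)
      finally show ?thesis .
    qed
    obtain A where A: "is_net CARD('m) A CARD('p)" "net_depth A = 2"
      "net_size A \<le> 9 * CARD('m)\<^sup>2 * (CARD('p) + 1) * (2 * q + 2) ^ (2 * CARD('m))"
      "continuous_on UNIV (net_fun A :: real ^ 'm \<Rightarrow> real ^ 'p)"
      "L2fun \<nu> (\<lambda>z. net_fun A z - F z)" "L2norm \<nu> (\<lambda>z. net_fun A z - F z) \<le> \<eta>"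
      by (rule grid_network_L2_approx[OF \<delta> _ _ box \<nu> F_meas b osc, of "\<eta>"]) (use \<eta> in auto)
    have q2: "2 * real q + 2 \<le> H * exp (\<kappa> * T)"
    proof -
      have "2 * real q + 2 \<le> 2 * (r / \<delta>) + 4 * 1" using q(2) by simp
      also have "\<dots> = 2 * r * L * ?m * exp (\<kappa> * T) + 4 * 1"
        by (simp add: \<delta>_def s_def exp_minus field_simps)
      also have "\<dots> \<le> 2 * r * L * ?m * exp (\<kappa> * T) + 4 * exp (\<kappa> * T)"
        using \<kappa> T by (intro add_left_mono mult_left_mono) auto
      also have "\<dots> = H * exp (\<kappa> * T)" by (simp add: H_def algebra_simps)
      finally show ?thesis .
    qed
    have "real (net_size A) \<le> real (9 * CARD('m)\<^sup>2 * (CARD('p) + 1) * (2 * q + 2) ^ (2 * CARD('m)))"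
      using A(3) by (rule of_nat_mono)
    also have "\<dots> = 9 * ?m\<^sup>2 * (real CARD('p) + 1) * (2 * real q + 2) ^ (2 * CARD('m))"
      by (simp add: algebra_simps)
    also have "\<dots> \<le> 9 * ?m\<^sup>2 * (real CARD('p) + 1) * (H * exp (\<kappa> * T)) ^ (2 * CARD('m))"
      using q2 by (intro mult_left_mono power_mono) auto
    also have "\<dots> = (9 * ?m\<^sup>2 * H ^ (2 * CARD('m))) * (real CARD('p) + 1) * exp (2 * \<kappa> * ?m * T)"
      by (simp add: power_mult_distrib exp_of_nat_mult[symmetric] algebra_simps)
    finally show ?thesis using A unfolding T_def by blast
  qed
  moreover have "9 * ?m\<^sup>2 * H ^ (2 * CARD('m)) > 0" "2 * \<kappa> > 0" using H \<kappa> by auto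
  ultimately show thesis using that by blast
qed

section \<open>Error of the DeepONet\<close>

text \<open>Every Lipschitz constant bounds each difference quotient, hence so does their infimum:
  the infimum in \<open>Lip\<close> is attained.\<close>

lemma Lip_lipschitz_on:
  assumes "\<exists>L. L-lipschitz_on UNIV f"
  shows "(Lip f)-lipschitz_on UNIV f"
proof (rule lipschitz_onI)
  let ?S = "{L. L-lipschitz_on UNIV f}"
  have ne: "?S \<noteq> {}" using assms by simp
  show "0 \<le> Lip f"
    unfolding Lip_def using ne by (intro cInf_greatest) (auto dest: lipschitz_on_nonneg)
  fix x y
  show "dist (f x) (f y) \<le> Lip f * dist x y"
  proof (cases "dist x y = 0")
    case False
    then have pos: "dist x y > 0" by simp
    have "dist (f x) (f y) / dist x y \<le> Lip f"
      unfolding Lip_def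
    proof (intro cInf_greatest ne)
      fix L assume "L \<in> ?S"
      then have "dist (f x) (f y) \<le> L * dist x y" by (auto dest: lipschitz_onD)
      then show "dist (f x) (f y) / dist x y \<le> L" using pos by (simp add: field_simps)
    qed
    then show ?thesis using pos by (simp add: field_simps)
  qed simp
qed

lemma Compl_supp: "- supp M = \<Union>{U. open U \<and> emeasure M U = 0}"
  by (auto simp: supp_def not_gr_zero)

text \<open>The complement of the support is a union of open null sets; by Lindelof countably many
  of them already cover it.\<close>

lemma AE_in_supp:
  fixes M :: "'a::second_countable_topology measure"
  assumes "sets M = sets borel"
  shows "AE x in M. x \<in> supp M"
proof -
  obtain F where F: "F \<subseteq> {U. open U \<and> emeasure M U = 0}" "countable F" "\<Union>F = - supp M"
    using Lindelof[of "{U. open U \<and> emeasure M U = 0}"] unfolding Compl_supp by auto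
  have "\<Union>F \<in> null_sets M"
  proof -
    have "(\<Union>U\<in>F. U) \<in> null_sets M"
      using F assms by (intro null_sets_UN') (auto intro!: null_setsI)
    then show ?thesis by simp
  qed
  then show ?thesis unfolding F(3) by (rule AE_I') auto
qed

text \<open>Integrates the weighted Young inequality \<open>young\<close>, which expands
  \<open>(t * u - s * v)\<^sup>2 \<ge> 0\<close>. With \<open>s\<close> and \<open>t\<close> close
  to the two norms, the right-hand side is close to the square of their sum.\<close>

lemma L2_triangle:
  fixes f g :: "'a \<Rightarrow> real"
  assumes [measurable]: "f \<in> borel_measurable M" "g \<in> borel_measurable M"
    and f: "integrable M (\<lambda>x. (f x)\<^sup>2)" and g: "integrable M (\<lambda>x. (g x)\<^sup>2)"
  shows "integrable M (\<lambda>x. (f x + g x)\<^sup>2)"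
    and "sqrt (\<integral>x. (f x + g x)\<^sup>2 \<partial>M) \<le> sqrt (\<integral>x. (f x)\<^sup>2 \<partial>M) + sqrt (\<integral>x. (g x)\<^sup>2 \<partial>M)"
proof -
  have young: "(u + v)\<^sup>2 \<le> (1 + t / s) * u\<^sup>2 + (1 + s / t) * v\<^sup>2" if "s > 0" "t > 0" for s t u v :: real
  proof -
    have "0 \<le> (t * u - s * v)\<^sup>2 / (s * t)" using that by simp
    also have "\<dots> = t / s * u\<^sup>2 + s / t * v\<^sup>2 - 2 * u * v"
      using that by (simp add: field_simps power2_eq_square)
    finally show ?thesis by (simp add: power2_eq_square algebra_simps)
  qed
  show int: "integrable M (\<lambda>x. (f x + g x)\<^sup>2)"
  proof (rule Bochner_Integration.integrable_bound)
    show "integrable M (\<lambda>x. (1 + 1 / 1) * (f x)\<^sup>2 + (1 + 1 / 1) * (g x)\<^sup>2)"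
      using f g by (intro Bochner_Integration.integrable_add integrable_mult_right) auto
    show "AE x in M. norm ((f x + g x)\<^sup>2) \<le> norm ((1 + 1 / 1) * (f x)\<^sup>2 + (1 + 1 / 1) * (g x)\<^sup>2)"
      using young[of 1 1] by (intro AE_I2) (simp add: abs_of_nonneg)
  qed measurable
  let ?a = "\<integral>x. (f x)\<^sup>2 \<partial>M" and ?b = "\<integral>x. (g x)\<^sup>2 \<partial>M"
  show "sqrt (\<integral>x. (f x + g x)\<^sup>2 \<partial>M) \<le> sqrt ?a + sqrt ?b"
  proof (rule field_le_epsilon)
    fix e :: real assume "e > 0"
    have a0: "?a \<ge> 0" and b0: "?b \<ge> 0" by simp_all
    \<comment> \<open>The shift by \<open>e / 2\<close> keeps both weights positive when a norm
      vanishes.\<close>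
    define s t where "s = sqrt ?a + e / 2" and "t = sqrt ?b + e / 2"
    have st: "s > 0" "t > 0"
      using \<open>e > 0\<close> a0 b0 by (auto simp: s_def t_def intro!: add_nonneg_pos)
    have sa: "?a \<le> s\<^sup>2"
      using \<open>e > 0\<close> a0 power_mono[of "sqrt ?a" s 2] by (simp add: s_def)
    have tb: "?b \<le> t\<^sup>2"
      using \<open>e > 0\<close> b0 power_mono[of "sqrt ?b" t 2] by (simp add: t_def)
    have "(\<integral>x. (f x + g x)\<^sup>2 \<partial>M) \<le> (\<integral>x. (1 + t / s) * (f x)\<^sup>2 + (1 + s / t) * (g x)\<^sup>2 \<partial>M)"
      using int f g young[OF st] by (intro integral_mono) auto
    also have "\<dots> = (1 + t / s) * ?a + (1 + s / t) * ?b"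
      using f g by simp
    also have "\<dots> \<le> (1 + t / s) * s\<^sup>2 + (1 + s / t) * t\<^sup>2"
      using sa tb st by (intro add_mono mult_left_mono) auto
    also have "\<dots> = (s + t)\<^sup>2"
      using st by (simp add: field_simps power2_eq_square)
    finally have "sqrt (\<integral>x. (f x + g x)\<^sup>2 \<partial>M) \<le> s + t"
      using st by (intro real_le_lsqrt) auto
    then show "sqrt (\<integral>x. (f x + g x)\<^sup>2 \<partial>M) \<le> sqrt ?a + sqrt ?b + e"
      by (simp add: s_def t_def)
  qed
qed

theorem theorem3p1:
  fixes DG :: "'x::{real_inner, banach, second_countable_topology} set"
    and G GG :: "'x \<Rightarrow> 'y::{real_inner, banach, second_countable_topology}"
    and \<mu> :: "'x measure"
    and E :: "'x \<Rightarrow> real ^ 'm::finite"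
    and D :: "real ^ 'm \<Rightarrow> 'x"
    and P :: "'y \<Rightarrow> real ^ 'p::finite"
    and R :: "real ^ 'p \<Rightarrow> 'y"
    and K :: "(real ^ 'm) set"
    and C_stab \<beta> \<tau> \<epsilon>m C2 :: real
    and \<epsilon>R :: "nat \<Rightarrow> real"
  assumes "closed DG"
    and "continuous_on DG G"
    and "continuous_on UNIV GG" and "\<And>x. x \<in> DG \<Longrightarrow> GG x = G x"
    and "C_stab > 0" and "0 < \<beta>" "\<beta> < 1" and "0 < \<tau>" "\<tau> < 1"
    and "\<And>x1 x2. x1 \<in> DG \<Longrightarrow> x2 \<in> DG \<Longrightarrow> norm (x1 - x2) \<le> \<tau> \<Longrightarrow>
           norm (G x1 - G x2) \<le> C_stab * log_modulus \<beta> (norm (x1 - x2))"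
    and "prob_space \<mu>" and "sets \<mu> = sets borel"
    and "measure \<mu> DG = 1"
    and "integrable \<mu> (\<lambda>x. (norm x)\<^sup>2)"
    and "L2fun \<mu> GG"
    and "E \<in> borel_measurable borel"
    and "K = supp (distr \<mu> borel E)" and "compact K"
    and "\<exists>L. L-lipschitz_on UNIV D"
    and "\<exists>L. L-lipschitz_on UNIV P"
    and "D ` K \<subseteq> DG"
    and "ereal \<epsilon>m = esssup \<mu> (\<lambda>x. ereal (norm (D (E x) - x)))"
    and "\<epsilon>m \<le> min \<tau> (exp (- 1))"
    and "reconstructor R"
    and "\<exists>L. L-lipschitz_on UNIV R"
    and "C2 > 0"
    and "L2norm (distr \<mu> borel GG) (\<lambda>v. R (P v) - v) \<le> C2 * \<epsilon>R CARD('p)"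
  shows "\<exists>c0 c1 c2 c3 :: real. c0 > 0 \<and> c1 > 0 \<and> c2 > 0 \<and> c3 > 0 \<and>
    (\<forall>N::nat. real N > c0 * (real CARD('p) + 1) * exp (c1 * real CARD('m)) \<longrightarrow>
      (\<exists>A. is_net CARD('m) A CARD('p) \<and> net_size A \<le> N \<and>
        L2fun \<mu> (\<lambda>f. GG f - (R \<circ> net_fun A \<circ> E) f) \<and>
        L2norm \<mu> (\<lambda>f. GG f - (R \<circ> net_fun A \<circ> E) f)
          \<le> Lip R * (1 / (c1 * real CARD('m)) * ln (real N / (c0 * (real CARD('p) + 1)))) powr (- \<beta>)
            + Lip (R \<circ> P) * C_stab * log_modulus \<beta> \<epsilon>m
            + C2 * \<epsilon>R CARD('p))) \<and>
    (\<forall>\<eta>. 0 < \<eta> \<and> \<eta> < 1 \<longrightarrow>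
      (\<exists>A. is_net CARD('m) A CARD('p) \<and>
        L2fun (restrict_space (distr \<mu> borel E) K) (\<lambda>z. net_fun A z - P (G (D z))) \<and>
        L2norm (restrict_space (distr \<mu> borel E) K) (\<lambda>z. net_fun A z - P (G (D z))) \<le> \<eta> \<and>
        real (net_size A)
          \<le> c0 * (real CARD('p) + 1) * exp (c1 * real CARD('m) * \<eta> powr (- 1 / \<beta>)) \<and>
        real (net_depth A) \<le> c2 + c3 * real CARD('m) * \<eta> powr (- 1 / \<beta>)))"
proof -

  \<comment> \<open>The law of the encoder and its restriction to \<open>K\<close>\<close>
  interpret \<mu>: prob_space \<mu> by fact
  note [measurable_cong] = \<open>sets \<mu> = sets borel\<close>
  have E_meas [measurable]: "E \<in> borel_measurable \<mu>"
    using \<open>E \<in> borel_measurable borel\<close> by measurable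
  define Q where "Q = distr \<mu> borel E"
  have setsQ [measurable_cong]: "sets Q = sets borel" by (simp add: Q_def)
  interpret Q: prob_space Q unfolding Q_def by (rule \<mu>.prob_space_distr) measurable
  have K_borel [measurable]: "K \<in> sets borel" using \<open>compact K\<close> by (rule borel_compact)
  define \<nu> where "\<nu> = restrict_space Q K"
  have K_sets: "K \<in> sets Q" unfolding setsQ by (rule K_borel)
  have K_Q: "K \<inter> space Q \<in> sets Q" by (intro sets.Int K_sets sets.top)
  have sets_\<nu>: "sets \<nu> = sets (restrict_space borel K)"
    unfolding \<nu>_def using setsQ by (rule sets_restrict_space_cong)
  have fin_\<nu>: "finite_measure \<nu>"
    unfolding \<nu>_def by (intro finite_measure_restrict_space Q.finite_measure_axioms K_sets)
  have mass_\<nu>: "measure \<nu> (space \<nu>) \<le> 1"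
    using K_Q K_sets by (simp add: \<nu>_def space_restrict_space measure_restrict_space)
  have AE_K: "AE x in \<mu>. E x \<in> K"
  proof -
    have "AE z in distr \<mu> borel E. z \<in> K"
      using AE_in_supp[OF setsQ] unfolding Q_def \<open>K = supp (distr \<mu> borel E)\<close> .
    then show ?thesis by (subst (asm) AE_distr_iff) (auto simp: E_meas)
  qed
  have AE_DG: "AE x in \<mu>. x \<in> DG"
    using \<open>measure \<mu> DG = 1\<close> \<open>closed DG\<close> by (subst \<mu>.AE_in_set_eq_1) auto

  \<comment> \<open>Logarithmic modulus of \<open>F\<close> and its network approximation\<close>
  obtain LP LD where LP: "LP-lipschitz_on UNIV P" and LD: "LD-lipschitz_on UNIV D"
    using \<open>\<exists>L. L-lipschitz_on UNIV P\<close> \<open>\<exists>L. L-lipschitz_on UNIV D\<close> by blast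
  have LP0: "LP \<ge> 0" and LD0: "LD \<ge> 0" using LP LD by (auto dest: lipschitz_on_nonneg)
  define F where "F z = P (G (D z))" for z
  have F_cont: "continuous_on K F"
    unfolding F_def
    by (intro continuous_on_compose2[OF lipschitz_on_continuous_on[OF LP]]
        continuous_on_compose2[OF \<open>continuous_on DG G\<close>]
        continuous_on_subset[OF lipschitz_on_continuous_on[OF LD]])
      (use \<open>D ` K \<subseteq> DG\<close> in auto)
  \<comment> \<open>The constants \<open>LP + 1\<close> and \<open>LD + 1\<close> are strictly
    positive, as the approximation lemma demands, even if \<open>P\<close> or \<open>D\<close> is
    constant.\<close>
  have modulus: "norm (F x - F y) \<le> (LP + 1) * C_stab * log_modulus \<beta> ((LD + 1) * norm (x - y))"
    if xy: "x \<in> K" "y \<in> K" and le: "(LD + 1) * norm (x - y) \<le> \<tau>" for x y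
  proof -
    have D: "norm (D x - D y) \<le> (LD + 1) * norm (x - y)"
      using lipschitz_onD[OF LD UNIV_I UNIV_I, of x y] norm_ge_zero[of "x - y"]
      unfolding dist_norm distrib_right mult_1 by linarith
    have "norm (F x - F y) \<le> LP * norm (G (D x) - G (D y))"
      using lipschitz_onD[OF LP, of "G (D x)" "G (D y)"] by (simp add: F_def dist_norm)
    also have "\<dots> \<le> (LP + 1) * (C_stab * log_modulus \<beta> (norm (D x - D y)))"
      using xy D le LP0 \<open>D ` K \<subseteq> DG\<close> by (intro mult_mono assms(10)) auto
    also have "\<dots> \<le> (LP + 1) * (C_stab * log_modulus \<beta> ((LD + 1) * norm (x - y)))"
      using D le LP0 \<open>\<tau> < 1\<close> \<open>0 < \<beta>\<close> \<open>C_stab > 0\<close>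
      by (intro mult_left_mono log_modulus_mono) auto
    finally show ?thesis by (simp add: mult.assoc)
  qed
  obtain c0 c1 where c: "c0 > 0" "c1 > 0" and approx: "\<And>\<eta>. 0 < \<eta> \<Longrightarrow> \<eta> < 1 \<Longrightarrow>
      \<exists>A. is_net CARD('m) A CARD('p) \<and> net_depth A = 2 \<and>
        continuous_on UNIV (net_fun A :: real ^ 'm \<Rightarrow> real ^ 'p) \<and>
        L2fun \<nu> (\<lambda>z. net_fun A z - F z) \<and> L2norm \<nu> (\<lambda>z. net_fun A z - F z) \<le> \<eta> \<and>
        real (net_size A) \<le> c0 * (real CARD('p) + 1) * exp (c1 * real CARD('m) * \<eta> powr (- 1 / \<beta>))"
    by (rule log_modulus_network_approx[OF \<open>compact K\<close> F_cont \<open>0 < \<beta>\<close> _ _ \<open>0 < \<tau>\<close> \<open>\<tau> < 1\<close> modulus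
          fin_\<nu> sets_\<nu> mass_\<nu>]) (use LP0 LD0 \<open>C_stab > 0\<close> in auto)

  \<comment> \<open>Reconstruction error \<open>a\<close> and encoding error
    \<open>b\<close>\<close>
  have R_lip: "(Lip R)-lipschitz_on UNIV R"
    by (rule Lip_lipschitz_on) fact
  have RP_lip: "(Lip (R \<circ> P))-lipschitz_on UNIV (R \<circ> P)"
    by (rule Lip_lipschitz_on) (use lipschitz_on_compose[OF LP lipschitz_on_subset[OF R_lip]] in auto)
  have R_cont: "continuous_on UNIV R" and RP_cont: "continuous_on UNIV (R \<circ> P)"
    using R_lip RP_lip by (auto dest: lipschitz_on_continuous_on)
  have R0: "Lip R \<ge> 0" and RP0: "Lip (R \<circ> P) \<ge> 0"
    using R_lip RP_lip by (auto dest: lipschitz_on_nonneg)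
  have [measurable]: "R \<in> borel_measurable borel" "(\<lambda>v. R (P v)) \<in> borel_measurable borel"
    using borel_measurable_continuous_onI[OF R_cont] borel_measurable_continuous_onI[OF RP_cont]
    by (simp_all add: comp_def)
  have GG_meas [measurable]: "GG \<in> borel_measurable \<mu>" and GG_int: "integrable \<mu> (\<lambda>x. (norm (GG x))\<^sup>2)"
    using \<open>L2fun \<mu> GG\<close> by (auto simp: L2fun_def)
  define a where "a x = norm (R (P (GG x)) - GG x)" for x
  define b where "b = Lip (R \<circ> P) * C_stab * log_modulus \<beta> \<epsilon>m"
  have b0: "b \<ge> 0" using RP0 \<open>C_stab > 0\<close> by (simp add: b_def log_modulus_def)
  have a_meas [measurable]: "a \<in> borel_measurable \<mu>" unfolding a_def by measurable
  \<comment> \<open>The bound on the norm of \<open>a\<close> does not imply integrability, since a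
    non-integrable square has integral 0. Integrability follows from the linear growth of
    \<open>R \<circ> P\<close> and the square integrability of \<open>GG\<close>.\<close>
  have a_int: "integrable \<mu> (\<lambda>x. (a x)\<^sup>2)"
  proof (rule Bochner_Integration.integrable_bound)
    have "integrable \<mu> (\<lambda>x. ((Lip (R \<circ> P) + 1) * norm (GG x))\<^sup>2)"
      unfolding power_mult_distrib by (intro integrable_mult_right GG_int)
    then show "integrable \<mu> (\<lambda>x. ((Lip (R \<circ> P) + 1) * norm (GG x) + norm (R (P 0)))\<^sup>2)"
      by (intro L2_triangle) auto
    have "a x \<le> (Lip (R \<circ> P) + 1) * norm (GG x) + norm (R (P 0))" for x
    proof -
      have "norm (R (P (GG x)) - R (P 0)) \<le> Lip (R \<circ> P) * norm (GG x)"
        using lipschitz_onD[OF RP_lip, of "GG x" 0] by (simp add: dist_norm)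
      moreover have "a x \<le> norm (R (P (GG x)) - R (P 0)) + norm (R (P 0)) + norm (GG x)"
        unfolding a_def by norm
      ultimately show ?thesis by (simp add: algebra_simps)
    qed
    then have "(a x)\<^sup>2 \<le> ((Lip (R \<circ> P) + 1) * norm (GG x) + norm (R (P 0)))\<^sup>2" for x
      by (intro power_mono) (simp_all add: a_def)
    then show "AE x in \<mu>. norm ((a x)\<^sup>2) \<le> norm (((Lip (R \<circ> P) + 1) * norm (GG x) + norm (R (P 0)))\<^sup>2)"
      by simp
  qed measurable
  have a_norm: "sqrt (\<integral>x. (a x)\<^sup>2 \<partial>\<mu>) \<le> C2 * \<epsilon>R CARD('p)"
  proof -
    have "L2norm (distr \<mu> borel GG) (\<lambda>v. R (P v) - v) = sqrt (\<integral>x. (a x)\<^sup>2 \<partial>\<mu>)"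
      unfolding L2norm_def a_def by (subst integral_distr) auto
    then show ?thesis using assms(27) by simp
  qed
  \<comment> \<open>Almost every \<open>x\<close> lies in \<open>DG\<close>, as does
    \<open>D (E x)\<close>, and they are at most \<open>\<epsilon>m \<le> \<tau>\<close> apart, so
    stability of \<open>G\<close> applies. If \<open>\<epsilon>m = 0\<close>, the two points
    coincide and both sides vanish.\<close>
  have stab: "AE x in \<mu>. norm (R (P (GG x)) - R (F (E x))) \<le> b"
  proof -
    have "AE x in \<mu>. ereal (norm (D (E x) - x)) \<le> ereal \<epsilon>m"
      unfolding \<open>ereal \<epsilon>m = _\<close> by (rule esssup_AE)
    then show ?thesis using AE_DG AE_K
    proof eventually_elim
      case (elim x)
      then have le: "norm (x - D (E x)) \<le> \<epsilon>m" by (simp add: norm_minus_commute)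
      have "\<epsilon>m \<le> \<tau>" "\<epsilon>m < 1" using \<open>\<epsilon>m \<le> min \<tau> (exp (- 1))\<close> \<open>\<tau> < 1\<close> by auto
      have DE: "D (E x) \<in> DG" using elim \<open>D ` K \<subseteq> DG\<close> by auto
      have "norm (R (P (GG x)) - R (F (E x))) \<le> Lip (R \<circ> P) * norm (G x - G (D (E x)))"
        using lipschitz_onD[OF RP_lip, of "G x" "G (D (E x))"] assms(4)[OF elim(2)]
        by (simp add: dist_norm F_def)
      also have "\<dots> \<le> Lip (R \<circ> P) * (C_stab * log_modulus \<beta> (norm (x - D (E x))))"
        using elim DE le \<open>\<epsilon>m \<le> \<tau>\<close> RP0 by (intro mult_left_mono assms(10)) auto
      also have "\<dots> \<le> Lip (R \<circ> P) * (C_stab * log_modulus \<beta> \<epsilon>m)"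
        using le \<open>\<epsilon>m < 1\<close> RP0 \<open>0 < \<beta>\<close> \<open>C_stab > 0\<close>
        by (intro mult_left_mono log_modulus_mono) auto
      finally show ?case by (simp add: b_def mult.assoc)
    qed
  qed

  \<comment> \<open>DeepONet error for a given network\<close>
  have deeponet: "L2fun \<mu> (\<lambda>f. GG f - (R \<circ> net_fun A \<circ> E) f) \<and>
      L2norm \<mu> (\<lambda>f. GG f - (R \<circ> net_fun A \<circ> E) f) \<le> Lip R * \<eta> + b + C2 * \<epsilon>R CARD('p)"
    if cont: "continuous_on UNIV (net_fun A :: real ^ 'm \<Rightarrow> real ^ 'p)"
      and L2: "L2fun \<nu> (\<lambda>z. net_fun A z - F z)" "L2norm \<nu> (\<lambda>z. net_fun A z - F z) \<le> \<eta>" for A \<eta>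
  proof -
    define h where "h z = indicator K z *\<^sub>R (net_fun A z - F z)" for z
    define e where "e x = Lip R * norm (h (E x))" for x
    have [measurable]: "(net_fun A :: real ^ 'm \<Rightarrow> real ^ 'p) \<in> borel_measurable borel"
      using cont by (rule borel_measurable_continuous_onI)
    have "h \<in> borel_measurable Q"
      using L2(1) K_Q unfolding L2fun_def \<nu>_def h_def by (simp add: borel_measurable_restrict_space_iff)
    then have h_meas [measurable]: "h \<in> borel_measurable borel"
      using measurable_cong_sets[OF setsQ refl] by blast
    have h2: "(norm (h z))\<^sup>2 = indicator K z *\<^sub>R (norm (net_fun A z - F z))\<^sup>2" for z
      by (simp add: h_def indicator_def)
    have "integrable Q (\<lambda>z. (norm (h z))\<^sup>2)"
      using L2(1) K_Q unfolding L2fun_def \<nu>_def h2 by (simp add: integrable_restrict_space)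
    then have h_int: "integrable \<mu> (\<lambda>x. (norm (h (E x)))\<^sup>2)"
      unfolding Q_def by (subst (asm) integrable_distr_eq) auto
    have "(\<integral>x. (norm (h (E x)))\<^sup>2 \<partial>\<mu>) = (\<integral>z. (norm (h z))\<^sup>2 \<partial>Q)"
      unfolding Q_def by (subst integral_distr) auto
    also have "\<dots> = (\<integral>z. (norm (net_fun A z - F z))\<^sup>2 \<partial>\<nu>)"
      unfolding \<nu>_def h2 by (rule integral_restrict_space[OF K_Q, symmetric])
    finally have h_norm: "sqrt (\<integral>x. (norm (h (E x)))\<^sup>2 \<partial>\<mu>) \<le> \<eta>"
      using L2(2) by (simp add: L2norm_def)
    have e_int: "integrable \<mu> (\<lambda>x. (e x)\<^sup>2)"
      unfolding e_def power_mult_distrib by (intro integrable_mult_right h_int)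
    have e_norm: "sqrt (\<integral>x. (e x)\<^sup>2 \<partial>\<mu>) \<le> Lip R * \<eta>"
      using h_norm R0 by (simp add: e_def power_mult_distrib real_sqrt_mult mult_left_mono)
    have e_meas [measurable]: "e \<in> borel_measurable \<mu>" unfolding e_def by measurable
    have be: "integrable \<mu> (\<lambda>x. (b + e x)\<^sup>2)"
      "sqrt (\<integral>x. (b + e x)\<^sup>2 \<partial>\<mu>) \<le> sqrt (\<integral>x. b\<^sup>2 \<partial>\<mu>) + sqrt (\<integral>x. (e x)\<^sup>2 \<partial>\<mu>)"
      by (intro L2_triangle e_int; simp)+
    have abe: "integrable \<mu> (\<lambda>x. (a x + (b + e x))\<^sup>2)"
      "sqrt (\<integral>x. (a x + (b + e x))\<^sup>2 \<partial>\<mu>) \<le> sqrt (\<integral>x. (a x)\<^sup>2 \<partial>\<mu>) + sqrt (\<integral>x. (b + e x)\<^sup>2 \<partial>\<mu>)"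
      by (intro L2_triangle a_int be; simp)+
    let ?N = "R \<circ> net_fun A \<circ> E"
    have N_meas [measurable]: "(\<lambda>f. GG f - ?N f) \<in> borel_measurable \<mu>"
      unfolding comp_def by measurable
    \<comment> \<open>The path from \<open>GG f\<close> to the DeepONet passes through
      \<open>R (P (GG f))\<close> and \<open>R (F (E f))\<close>; its three legs cost
      \<open>a\<close>, \<open>b\<close> and \<open>e\<close>.\<close>
    have bound: "AE f in \<mu>. (norm (GG f - ?N f))\<^sup>2 \<le> (a f + (b + e f))\<^sup>2"
      using stab AE_K
    proof eventually_elim
      case (elim x)
      have "norm (R (F (E x)) - R (net_fun A (E x))) \<le> e x"
        using lipschitz_onD[OF R_lip, of "F (E x)" "net_fun A (E x)"] elim(2)
        by (simp add: e_def h_def dist_norm norm_minus_commute)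
      moreover have "norm (GG x - ?N x) \<le> a x + (norm (R (P (GG x)) - R (F (E x)))
          + norm (R (F (E x)) - R (net_fun A (E x))))"
        unfolding a_def comp_def by norm
      ultimately have "norm (GG x - ?N x) \<le> a x + (b + e x)" using elim(1) by linarith
      then show ?case by (intro power_mono) auto
    qed
    have N_int: "integrable \<mu> (\<lambda>f. (norm (GG f - ?N f))\<^sup>2)"
      by (rule Bochner_Integration.integrable_bound[OF abe(1)]) (use bound in simp_all)
    have "L2norm \<mu> (\<lambda>f. GG f - ?N f) \<le> sqrt (\<integral>x. (a x + (b + e x))\<^sup>2 \<partial>\<mu>)"
      unfolding L2norm_def using integral_mono_AE[OF N_int abe(1) bound] by simp
    \<comment> \<open>The constant \<open>b\<close> has L2 norm \<open>b\<close> because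
      \<open>\<mu>\<close> is a probability measure.\<close>
    also have "\<dots> \<le> C2 * \<epsilon>R CARD('p) + (b + Lip R * \<eta>)"
      using abe(2) be(2) a_norm e_norm b0 by (simp add: \<mu>.prob_space)
    finally show ?thesis using N_int N_meas unfolding L2fun_def by simp
  qed

  \<comment> \<open>Claim (i): accuracy for a prescribed size\<close>
  have size: "\<exists>A. is_net CARD('m) A CARD('p) \<and> net_size A \<le> N \<and>
        L2fun \<mu> (\<lambda>f. GG f - (R \<circ> net_fun A \<circ> E) f) \<and>
        L2norm \<mu> (\<lambda>f. GG f - (R \<circ> net_fun A \<circ> E) f)
          \<le> Lip R * (1 / (c1 * real CARD('m)) * ln (real N / (c0 * (real CARD('p) + 1)))) powr (- \<beta>)
            + Lip (R \<circ> P) * C_stab * log_modulus \<beta> \<epsilon>m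
            + C2 * \<epsilon>R CARD('p)"
    if N: "real N > c0 * (real CARD('p) + 1) * exp (c1 * real CARD('m))" for N :: nat
  proof -
    let ?c = "c0 * (real CARD('p) + 1)" and ?d = "c1 * real CARD('m)"
    \<comment> \<open>Solves \<open>?c * exp (?d * T) = N\<close>. The hypothesis on
      \<open>N\<close> says exactly \<open>T > 1\<close>, so
      \<open>\<eta> = T powr (- \<beta>)\<close> is an admissible accuracy and is also the rate in
      the claim.\<close>
    define T where "T = 1 / ?d * ln (real N / ?c)"
    have pos: "?c > 0" "?d > 0" using c by auto
    then have N0: "real N > 0" using N by (meson exp_gt_zero mult_pos_pos order_less_trans)
    have ln_exp: "exp (ln (real N / ?c)) = real N / ?c"
      using N0 pos by (intro exp_ln divide_pos_pos)
    have "exp ?d < exp (ln (real N / ?c))"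
      unfolding ln_exp using N pos by (simp add: pos_less_divide_eq mult.commute)
    then have "?d < ln (real N / ?c)" by (simp only: exp_less_cancel_iff)
    then have T: "T > 1" using pos by (simp add: T_def field_simps)
    define \<eta> where "\<eta> = T powr (- \<beta>)"
    have \<eta>: "0 < \<eta>" "\<eta> < 1"
      using T \<open>0 < \<beta>\<close> powr_less_mono[of "- \<beta>" 0 T] by (auto simp: \<eta>_def)
    have \<eta>T: "\<eta> powr (- 1 / \<beta>) = T" using T \<open>0 < \<beta>\<close> by (simp add: \<eta>_def powr_powr)
    have "?d * T = ln (real N / ?c)" using c by (simp add: T_def)
    then have expT: "?c * exp (?d * T) = real N"
      unfolding \<open>?d * T = _\<close> ln_exp using pos(1)
      by (metis less_irrefl nonzero_mult_div_cancel_left times_divide_eq_right)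
    obtain A where A: "is_net CARD('m) A CARD('p)"
        "continuous_on UNIV (net_fun A :: real ^ 'm \<Rightarrow> real ^ 'p)"
        "L2fun \<nu> (\<lambda>z. net_fun A z - F z)" "L2norm \<nu> (\<lambda>z. net_fun A z - F z) \<le> \<eta>"
        "real (net_size A) \<le> ?c * exp (?d * \<eta> powr (- 1 / \<beta>))"
      using approx[OF \<eta>] by blast
    have "net_size A \<le> N" using A(5) unfolding \<eta>T expT by simp
    then show ?thesis using A(1) deeponet[OF A(2-4)] unfolding \<eta>_def T_def b_def by blast
  qed

  \<comment> \<open>Claim (ii): size and depth for a prescribed accuracy\<close>
  have "\<exists>A. is_net CARD('m) A CARD('p) \<and>
        L2fun \<nu> (\<lambda>z. net_fun A z - P (G (D z))) \<and>
        L2norm \<nu> (\<lambda>z. net_fun A z - P (G (D z))) \<le> \<eta> \<and>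
        real (net_size A)
          \<le> c0 * (real CARD('p) + 1) * exp (c1 * real CARD('m) * \<eta> powr (- 1 / \<beta>)) \<and>
        real (net_depth A) \<le> 2 + 1 * real CARD('m) * \<eta> powr (- 1 / \<beta>)"
    if \<eta>: "0 < \<eta>" "\<eta> < 1" for \<eta>
  proof -
    obtain A where A: "is_net CARD('m) A CARD('p)" "net_depth A = 2"
        "L2fun \<nu> (\<lambda>z. net_fun A z - F z)" "L2norm \<nu> (\<lambda>z. net_fun A z - F z) \<le> \<eta>"
        "real (net_size A) \<le> c0 * (real CARD('p) + 1) * exp (c1 * real CARD('m) * \<eta> powr (- 1 / \<beta>))"
      using approx[OF \<eta>] by blast
    have "real (net_depth A) \<le> 2 + 1 * real CARD('m) * \<eta> powr (- 1 / \<beta>)" using A(2) by simp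
    with A show ?thesis unfolding F_def by blast
  qed
  then show ?thesis
    unfolding \<nu>_def Q_def using size c
    \<comment> \<open>Every network has depth 2, so \<open>c2 = 2\<close> suffices and
      \<open>c3 = 1\<close> is an arbitrary positive choice.\<close>
    by (intro exI[of _ c0] exI[of _ c1] exI[of _ 2] exI[of _ 1] conjI allI impI) (auto simp del: mult_1)
qed

end
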